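(* Let $X$ be a finite non-empty set and $R$ a monotone transit function on $X$ satisfying (wp): for all $u,v,x,y,p,q\in X$, if $R(u,v)\cap R(x,y)$, $R(u,v)\cap R(p,q)$ and $R(x,y)\cap R(p,q)$ are all non-empty, then $R(p,q)\subseteq R(u,v)\cup R(x,y)$ or $R(u,v)\subseteq R(p,q)\cup R(x,y)$ or $R(x,y)\subseteq R(p,q)\cup R(u,v)$. Then $R$ satisfies (o'): for all $u,v\in X$ and every $z\in R(u,v)$ there exist $p,q\in R(u,v)$ such that $R(p,z)\cup R(z,q)=R(u,v)$.
   Context: A transit function on a finite non-empty set $X$ is a map $R:X\times X\to 2^X$ such that for all $u,v\in X$: $u\in R(u,v)$, $R(u,v)=R(v,u)$, and $R(u,u)=\{u\}$. $R$ is monotone if for all $u,v,p,q\in X$, $p,q\in R(u,v)$ implies $R(p,q)\subseteq R(u,v)$. *)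

theory Defs
  imports Main
begin

text \<open>
  A map \<open>X \<times> X \<rightarrow> 2\<^sup>X\<close> is rendered as a curried function on the ambient type; its values
  outside the carrier \<open>X\<close> are left unconstrained and never used.
\<close>

definition transit_function :: "'a set \<Rightarrow> ('a \<Rightarrow> 'a \<Rightarrow> 'a set) \<Rightarrow> bool" where
  "transit_function X R \<longleftrightarrow>
     (\<forall>u\<in>X. \<forall>v\<in>X. R u v \<subseteq> X) \<and>
     (\<forall>u\<in>X. \<forall>v\<in>X. u \<in> R u v) \<and>
     (\<forall>u\<in>X. \<forall>v\<in>X. R u v = R v u) \<and>
     (\<forall>u\<in>X. R u u = {u})"

definition monotone_transit :: "'a set \<Rightarrow> ('a \<Rightarrow> 'a \<Rightarrow> 'a set) \<Rightarrow> bool" where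
  "monotone_transit X R \<longleftrightarrow>
     (\<forall>u\<in>X. \<forall>v\<in>X. \<forall>p\<in>X. \<forall>q\<in>X.
        p \<in> R u v \<and> q \<in> R u v \<longrightarrow> R p q \<subseteq> R u v)"

definition axiom_wp :: "'a set \<Rightarrow> ('a \<Rightarrow> 'a \<Rightarrow> 'a set) \<Rightarrow> bool" where
  "axiom_wp X R \<longleftrightarrow>
     (\<forall>u\<in>X. \<forall>v\<in>X. \<forall>x\<in>X. \<forall>y\<in>X. \<forall>p\<in>X. \<forall>q\<in>X.
        R u v \<inter> R x y \<noteq> {} \<and> R u v \<inter> R p q \<noteq> {} \<and> R x y \<inter> R p q \<noteq> {} \<longrightarrow>
        R p q \<subseteq> R u v \<union> R x y \<or> R u v \<subseteq> R p q \<union> R x y \<or> R x y \<subseteq> R p q \<union> R u v)"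

definition axiom_o' :: "'a set \<Rightarrow> ('a \<Rightarrow> 'a \<Rightarrow> 'a set) \<Rightarrow> bool" where
  "axiom_o' X R \<longleftrightarrow>
     (\<forall>u\<in>X. \<forall>v\<in>X. \<forall>z\<in>R u v. \<exists>p\<in>R u v. \<exists>q\<in>R u v. R p z \<union> R z q = R u v)"

end

(* The intervals R(z,p) with p in R(u,v) cover R(u,v), so it suffices that at most two of them are
   maximal. Three of them pairwise meet in z, hence by (wp) one lies in the union of the other two;
   its endpoint then lies in one of these, which by monotonicity contains the whole interval. *)
theory Submission
  imports Defs
begin

lemma finite_ex_maximal_image:
  fixes f :: "'a \<Rightarrow> 'b set"
  assumes "finite A" and "A \<noteq> {}"
  shows "\<exists>p\<in>A. \<forall>r\<in>A. \<not> f p \<subset> f r"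
proof -
  have "finite (f ` A)" and "f ` A \<noteq> {}"
    using assms by auto
  then obtain M where "M \<in> f ` A" and "\<forall>N\<in>f ` A. M \<subseteq> N \<longrightarrow> M = N"
    by (meson finite_has_maximal)
  then show ?thesis
    by auto
qed

theorem theorem5:
  fixes X :: "'a set" and R :: "'a \<Rightarrow> 'a \<Rightarrow> 'a set"
  assumes "finite X" and "X \<noteq> {}"
    and "transit_function X R"
    and "monotone_transit X R"
    and "axiom_wp X R"
  shows "axiom_o' X R"
  unfolding axiom_o'_def
proof (intro ballI)
  fix u v z
  assume u: "u \<in> X" and v: "v \<in> X" and z: "z \<in> R u v"
  have SX: "R u v \<subseteq> X"
    using assms(3) u v by (simp add: transit_function_def)
  then have fin: "finite (R u v)" and zX: "z \<in> X"
    using assms(1) z finite_subset by auto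
  have left: "x \<in> R x y" and sym: "R x y = R y x" if "x \<in> X" "y \<in> X" for x y
    using assms(3) that by (auto simp: transit_function_def)
  have right: "y \<in> R x y" if "x \<in> X" "y \<in> X" for x y
    using left[OF that(2,1)] sym[OF that] by simp
  have mono: "R p q \<subseteq> R x y"
    if "x \<in> X" "y \<in> X" "p \<in> X" "q \<in> X" "p \<in> R x y" "q \<in> R x y" for x y p q
    using assms(4) that by (simp add: monotone_transit_def)
  \<comment> \<open>Since \<open>z\<close> lies in every \<open>R z b\<close>, monotonicity reduces
    inclusion of two intervals from \<open>z\<close> to membership of one endpoint.\<close>
  have mono_z: "R z a \<subseteq> R z b" if "a \<in> X" "b \<in> X" "a \<in> R z b" for a b
    using mono[OF zX _ zX] left[OF zX] that by simp
  have sub: "R z r \<subseteq> R u v" if "r \<in> R u v" for r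
    using mono[OF u v zX _ z] that SX by auto
  \<comment> \<open>The three intervals share \<open>z\<close>, so (wp) applies; each contains its
    far endpoint, and only the membership of that endpoint is kept.\<close>
  have wp: "c \<in> R z a \<union> R z b \<or> a \<in> R z c \<union> R z b \<or> b \<in> R z c \<union> R z a"
    if X: "a \<in> X" "b \<in> X" "c \<in> X" for a b c
  proof -
    have "z \<in> R z a" "z \<in> R z b" "z \<in> R z c"
      using X left[OF zX] by auto
    then have "R z c \<subseteq> R z a \<union> R z b \<or> R z a \<subseteq> R z c \<union> R z b \<or> R z b \<subseteq> R z c \<union> R z a"
      using assms(5)[unfolded axiom_wp_def, rule_format, of z a z b z c] X zX by auto
    then show ?thesis
      using X[THEN right[OF zX]] by blast
  qed
  obtain p where p: "p \<in> R u v" and p_max: "\<forall>r\<in>R u v. \<not> R z p \<subset> R z r"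
    using finite_ex_maximal_image[OF fin, of "R z"] z by auto
  have "\<exists>q\<in>R u v. R z p \<union> R z q = R u v"
  proof (cases "R u v \<subseteq> R z p")
    case True
    then show ?thesis
      using sub[OF p] p by blast
  next
    case False
    then have "R u v - R z p \<noteq> {}"
      by blast
    \<comment> \<open>Maximality is asked only among points outside \<open>R z p\<close>. This
      suffices, because a point \<open>r\<close> missed by both intervals is itself such a
      competitor.\<close>
    then obtain q where q: "q \<in> R u v - R z p"
      and q_max: "\<forall>r\<in>R u v - R z p. \<not> R z q \<subset> R z r"
      using finite_ex_maximal_image[of "R u v - R z p" "R z"] fin by auto
    have "r \<in> R z p \<union> R z q" if r: "r \<in> R u v" for r
    proof (rule ccontr)
      assume nr: "r \<notin> R z p \<union> R z q"
      have X: "p \<in> X" "q \<in> X" "r \<in> X"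
        using p q r SX by auto
      \<comment> \<open>Otherwise \<open>mono_z\<close> gives \<open>R z p\<close> \<subseteq>
        \<open>R z q\<close>, and this is strict because \<open>q\<close> lies outside
        \<open>R z p\<close>, against the choice of \<open>p\<close>. In the next two claims
        \<open>r\<close> is the point that makes the inclusion strict.\<close>
      have "p \<notin> R z q"
        using bspec[OF p_max, of q] mono_z[OF X(1,2)] right[OF zX X(2)] q by blast
      moreover have "p \<notin> R z r"
        using bspec[OF p_max, of r] mono_z[OF X(1,3)] right[OF zX X(3)] r nr by blast
      moreover have "q \<notin> R z r"
        using bspec[OF q_max, of r] mono_z[OF X(2,3)] right[OF zX X(3)] r nr by blast
      \<comment> \<open>Each of \<open>p\<close>, \<open>q\<close>, \<open>r\<close> now lies
        outside the intervals from \<open>z\<close> to the other two, which rules out all cases of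
        \<open>wp\<close>.\<close>
      ultimately show False
        using wp[OF X] nr q by blast
    qed
    then show ?thesis
      using sub[OF p] sub[of q] q by blast
  qed
  moreover have "R z p = R p z"
    using sym[OF zX] p SX by blast
  ultimately show "\<exists>p\<in>R u v. \<exists>q\<in>R u v. R p z \<union> R z q = R u v"
    using p by auto
qed

end
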